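(* Let $u\colon\mathbb{R}^3\to\mathbb{R}$ and let $U$ be its octonion Fourier transform. Let $U^{\partial x_i\ldots x_j}$ denote the octonion Fourier transform of the partial derivative $u_{x_i\ldots x_j}$. Then, with $\odot$ the multiplication of the algebra $\mathbb{F}$ of quadruple-complex numbers, for all $\mathbf{f}=(f_1,f_2,f_3)\in\mathbb{R}^3$ $$\begin{aligned} U^{\partial x_1}(\mathbf{f})&=U(\mathbf{f})\odot(2\pi f_1)\mathbf{e}_1, \\ U^{\partial x_2}(\mathbf{f})&=U(\mathbf{f})\odot(2\pi f_2)\mathbf{e}_2, \\ U^{\partial x_1x_2}(\mathbf{f})&=U(\mathbf{f})\odot(2\pi f_1)(2\pi f_2)\mathbf{e}_3, \\ U^{\partial x_3}(\mathbf{f})&=U(\mathbf{f})\odot(2\pi f_3)\mathbf{e}_4, \\ U^{\partial x_1x_3}(\mathbf{f})&=U(\mathbf{f})\odot(2\pi f_1)(2\pi f_3)\mathbf{e}_5, \\ U^{\partial x_2x_3}(\mathbf{f})&=U(\mathbf{f})\odot(2\pi f_2)(2\pi f_3)\mathbf{e}_6, \\ U^{\partial x_1x_2x_3}(\mathbf{f})&=U(\mathbf{f})\odot(2\pi f_1)(2\pi f_2)(2\pi f_3)\mathbf{e}_7.\end{aligned}$$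
   Context: $\mathbb{O}$ denotes the real algebra of octonions with basis $1,\mathbf{e}_1,\dots,\mathbf{e}_7$: an octonion is a pair $(q_0,q_1)$ of quaternions (quaternion units $\mathbf{e}_1,\mathbf{e}_2,\mathbf{e}_3$ with $\mathbf{e}_1\mathbf{e}_2=\mathbf{e}_3$), with product $(q_0,q_1)\cdot(p_0,p_1)=(q_0p_0-p_1^*q_1,\;p_1q_0+q_1p_0^* )$, where $^*$ is quaternion conjugation, and $\mathbf{e}_4=(0,1)$, $\mathbf{e}_5=(0,\mathbf{e}_1)$, $\mathbf{e}_6=(0,\mathbf{e}_2)$, $\mathbf{e}_7=(0,\mathbf{e}_3)$. The product is neither commutative nor associative; products without brackets are evaluated from left to right, i.e. $abcd=((ab)c)d$. For an imaginary unit $\mathbf{e}_k$ and $\alpha\in\mathbb{R}$, $e^{\mathbf{e}_k\alpha}=\cos\alpha+\mathbf{e}_k\sin\alpha$. Integrals of octonion-valued functions are taken componentwise. The octonion Fourier transform (OFT) of a Lebesgue integrable $u\colon\mathbb{R}^3\to\mathbb{O}$ is $$U(\mathbf{f})=\int_{\mathbb{R}^3}u(\mathbf{x})\,e^{-\mathbf{e}_1 2\pi f_1x_1}\,e^{-\mathbf{e}_2 2\pi f_2x_2}\,e^{-\mathbf{e}_4 2\pi f_3x_3}\,d\mathbf{x},\qquad \mathbf{f}=(f_1,f_2,f_3)\in\mathbb{R}^3,$$ with multiplication from left to right. The algebra $\mathbb{F}$ of quadruple-complex numbers has the same underlying real vector space with basis $1,\mathbf{e}_1,\dots,\mathbf{e}_7$;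 an element $p=p_0+p_1\mathbf{e}_1+\dots+p_7\mathbf{e}_7$ is identified with the quadruple of complex numbers $(s_0,s_1,s_2,s_3)$, $s_0=p_0+p_1\mathbf{e}_1$, $s_1=p_2+p_3\mathbf{e}_1$, $s_2=p_4+p_5\mathbf{e}_1$, $s_3=p_6+p_7\mathbf{e}_1$ (with $\mathbf{e}_1$ as the complex imaginary unit), and thereby with the octonion having the same coordinates. Multiplication in $\mathbb{F}$ is $$(s_0,s_1,s_2,s_3)\odot(t_0,t_1,t_2,t_3)=(s_0t_0-s_1t_1-s_2t_2+s_3t_3,\ s_0t_1+s_1t_0-s_2t_3-s_3t_2,\ s_0t_2+s_2t_0-s_1t_3-s_3t_1,\ s_0t_3+s_3t_0+s_1t_2+s_2t_1).$$ Standing assumptions: $u$ is Lebesgue integrable, and all partial derivatives of $u$ appearing in the statement exist (everywhere on $\mathbb{R}^3$) and are Lebesgue integrable, so that their OFTs exist. *)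

theory Defs
  imports "HOL-Analysis.Analysis"
begin

section \<open>Quaternions and octonions\<close>

text \<open>The quaternion with coordinates \<open>a, b, c, d\<close> with respect to \<open>1\<close> and the units \<open>\<e>\<^sub>1, \<e>\<^sub>2, \<e>\<^sub>3\<close> is the tuple \<open>(a, b, c, d)\<close>, an octonion is a pair of
  quaternions.  Using product types, both are Euclidean spaces, so that addition, real scalar
  multiplication and (componentwise) Bochner integration come from the library.\<close>

type_synonym quaternion = "real \<times> real \<times> real \<times> real"

type_synonym octonion = "quaternion \<times> quaternion"

fun quat_mult :: "quaternion \<Rightarrow> quaternion \<Rightarrow> quaternion"  (infixl "\<cdot>\<^sub>H" 70) where
  "(a, b, c, d) \<cdot>\<^sub>H (a', b', c', d') =
     (a * a' - b * b' - c * c' - d * d',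
      a * b' + b * a' + c * d' - d * c',
      a * c' - b * d' + c * a' + d * b',
      a * d' + b * c' - c * b' + d * a')"

fun quat_cnj :: "quaternion \<Rightarrow> quaternion" where
  "quat_cnj (a, b, c, d) = (a, - b, - c, - d)"

fun oct_mult :: "octonion \<Rightarrow> octonion \<Rightarrow> octonion"  (infixl "\<cdot>\<^sub>O" 70) where
  "(q0, q1) \<cdot>\<^sub>O (p0, p1) =
     (q0 \<cdot>\<^sub>H p0 - quat_cnj p1 \<cdot>\<^sub>H q1, p1 \<cdot>\<^sub>H q0 + q1 \<cdot>\<^sub>H quat_cnj p0)"

definition oct_of_real :: "real \<Rightarrow> octonion" where
  "oct_of_real r = ((r, 0, 0, 0), 0)"

definition \<e>\<^sub>1 :: octonion where "\<e>\<^sub>1 = ((0, 1, 0, 0), (0, 0, 0, 0))"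
definition \<e>\<^sub>2 :: octonion where "\<e>\<^sub>2 = ((0, 0, 1, 0), (0, 0, 0, 0))"
definition \<e>\<^sub>3 :: octonion where "\<e>\<^sub>3 = ((0, 0, 0, 1), (0, 0, 0, 0))"
definition \<e>\<^sub>4 :: octonion where "\<e>\<^sub>4 = ((0, 0, 0, 0), (1, 0, 0, 0))"
definition \<e>\<^sub>5 :: octonion where "\<e>\<^sub>5 = ((0, 0, 0, 0), (0, 1, 0, 0))"
definition \<e>\<^sub>6 :: octonion where "\<e>\<^sub>6 = ((0, 0, 0, 0), (0, 0, 1, 0))"
definition \<e>\<^sub>7 :: octonion where "\<e>\<^sub>7 = ((0, 0, 0, 0), (0, 0, 0, 1))"

lemmas oct_unit_defs = \<e>\<^sub>1_def \<e>\<^sub>2_def \<e>\<^sub>3_def \<e>\<^sub>4_def \<e>\<^sub>5_def \<e>\<^sub>6_def \<e>\<^sub>7_def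

lemma oct_unit_products:
  "\<e>\<^sub>1 \<cdot>\<^sub>O \<e>\<^sub>2 = \<e>\<^sub>3" "\<e>\<^sub>1 \<cdot>\<^sub>O \<e>\<^sub>4 = \<e>\<^sub>5" "\<e>\<^sub>2 \<cdot>\<^sub>O \<e>\<^sub>4 = \<e>\<^sub>6" "\<e>\<^sub>1 \<cdot>\<^sub>O \<e>\<^sub>2 \<cdot>\<^sub>O \<e>\<^sub>4 = \<e>\<^sub>7"
  by (simp_all add: oct_unit_defs zero_prod_def)

text \<open>\<open>oct_exp e \<alpha>\<close> is \<open>exp (e \<alpha>)\<close> for an imaginary unit \<open>e\<close>.\<close>

definition oct_exp :: "octonion \<Rightarrow> real \<Rightarrow> octonion" where
  "oct_exp e \<alpha> = oct_of_real (cos \<alpha>) + sin \<alpha> *\<^sub>R e"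


section \<open>The octonion Fourier transform\<close>

definition OFT :: "(real^3 \<Rightarrow> octonion) \<Rightarrow> real^3 \<Rightarrow> octonion" where
  "OFT u f = (\<integral>x. u x \<cdot>\<^sub>O oct_exp \<e>\<^sub>1 (- (2 * pi * f $ 1 * x $ 1))
                     \<cdot>\<^sub>O oct_exp \<e>\<^sub>2 (- (2 * pi * f $ 2 * x $ 2))
                     \<cdot>\<^sub>O oct_exp \<e>\<^sub>4 (- (2 * pi * f $ 3 * x $ 3)) \<partial>lebesgue)"

abbreviation OFT_real :: "(real^3 \<Rightarrow> real) \<Rightarrow> real^3 \<Rightarrow> octonion" where
  "OFT_real u \<equiv> OFT (\<lambda>x. oct_of_real (u x))"

lemma integrable_prod_componentwise:
  fixes g :: "'a \<Rightarrow> 'b::euclidean_space" and h :: "'a \<Rightarrow> 'c::euclidean_space"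
  assumes "integrable M g" "integrable M h"
  shows "integrable M (\<lambda>x. (g x, h x))"
proof -
  have "integrable M (\<lambda>x. (g x, 0::'c) + (0::'b, h x))"
    using assms
    by (intro Bochner_Integration.integrable_add
        integrable_bounded_linear[OF bounded_linear_Pair[OF bounded_linear_ident bounded_linear_zero]]
        integrable_bounded_linear[OF bounded_linear_Pair[OF bounded_linear_zero bounded_linear_ident]])
  then show ?thesis by simp
qed

lemma integral_prod_componentwise:
  fixes g :: "'a \<Rightarrow> 'b::euclidean_space" and h :: "'a \<Rightarrow> 'c::euclidean_space"
  assumes "integrable M g" "integrable M h"
  shows "(\<integral>x. (g x, h x) \<partial>M) = ((\<integral>x. g x \<partial>M), (\<integral>x. h x \<partial>M))"
  using integral_bounded_linear[OF bounded_linear_fst integrable_prod_componentwise[OF assms]]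
    integral_bounded_linear[OF bounded_linear_snd integrable_prod_componentwise[OF assms]]
  by (simp add: prod_eq_iff)

lemma integral_octonion_componentwise:
  fixes g0 g1 g2 g3 g4 g5 g6 g7 :: "'a \<Rightarrow> real"
  assumes "integrable M g0" "integrable M g1" "integrable M g2" "integrable M g3"
    and "integrable M g4" "integrable M g5" "integrable M g6" "integrable M g7"
  shows "(\<integral>x. ((g0 x, g1 x, g2 x, g3 x), (g4 x, g5 x, g6 x, g7 x)) \<partial>M) =
    (((\<integral>x. g0 x \<partial>M), (\<integral>x. g1 x \<partial>M), (\<integral>x. g2 x \<partial>M), (\<integral>x. g3 x \<partial>M)),
     ((\<integral>x. g4 x \<partial>M), (\<integral>x. g5 x \<partial>M), (\<integral>x. g6 x \<partial>M), (\<integral>x. g7 x \<partial>M)))"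
  using assms
  by (simp add: integral_prod_componentwise integrable_prod_componentwise)


section \<open>Quadruple-complex numbers\<close>

text \<open>The quadruple-complex product is transported to octonions along the identification of the
  underlying real vector spaces, with \<open>\<e>\<^sub>1\<close> as the complex imaginary unit.\<close>

type_synonym quadruple = "complex \<times> complex \<times> complex \<times> complex"

fun quadruple_mult :: "quadruple \<Rightarrow> quadruple \<Rightarrow> quadruple" where
  "quadruple_mult (s0, s1, s2, s3) (t0, t1, t2, t3) =
     (s0 * t0 - s1 * t1 - s2 * t2 + s3 * t3,
      s0 * t1 + s1 * t0 - s2 * t3 - s3 * t2,
      s0 * t2 + s2 * t0 - s1 * t3 - s3 * t1,
      s0 * t3 + s3 * t0 + s1 * t2 + s2 * t1)"

fun quadruple_of_oct :: "octonion \<Rightarrow> quadruple" where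
  "quadruple_of_oct ((p0, p1, p2, p3), (p4, p5, p6, p7)) =
     (Complex p0 p1, Complex p2 p3, Complex p4 p5, Complex p6 p7)"

fun oct_of_quadruple :: "quadruple \<Rightarrow> octonion" where
  "oct_of_quadruple (s0, s1, s2, s3) =
     ((Re s0, Im s0, Re s1, Im s1), (Re s2, Im s2, Re s3, Im s3))"

lemma oct_of_quadruple_of_oct: "oct_of_quadruple (quadruple_of_oct p) = p"
  by (cases p rule: quadruple_of_oct.cases) simp

lemma quadruple_of_oct_of_quadruple: "quadruple_of_oct (oct_of_quadruple s) = s"
  by (cases s rule: oct_of_quadruple.cases) simp

definition quadruple_oct_mult :: "octonion \<Rightarrow> octonion \<Rightarrow> octonion"  (infixl "\<odot>" 70) where
  "p \<odot> q = oct_of_quadruple (quadruple_mult (quadruple_of_oct p) (quadruple_of_oct q))"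


section \<open>Partial derivatives\<close>

text \<open>Subscripts of iterated partial derivatives are read from left to right: \<open>u\<close> differentiated
  with respect to \<open>x\<^sub>i\<close> and then \<open>x\<^sub>j\<close> is \<open>partial_deriv j (partial_deriv i u)\<close>.\<close>

definition has_partial_deriv :: "'n::finite \<Rightarrow> (real^'n \<Rightarrow> real) \<Rightarrow> real^'n \<Rightarrow> bool" where
  "has_partial_deriv i u x \<longleftrightarrow> (\<lambda>t. u (x + t *\<^sub>R axis i 1)) differentiable (at 0)"

definition partial_deriv :: "'n::finite \<Rightarrow> (real^'n \<Rightarrow> real) \<Rightarrow> real^'n \<Rightarrow> real" where
  "partial_deriv i u x = deriv (\<lambda>t. u (x + t *\<^sub>R axis i 1)) 0"

definition has_integrable_partial_deriv :: "'n::finite \<Rightarrow> (real^'n \<Rightarrow> real) \<Rightarrow> bool" where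
  "has_integrable_partial_deriv i u \<longleftrightarrow>
     (\<forall>x. has_partial_deriv i u x) \<and> integrable lebesgue (partial_deriv i u)"

end

theory Submission
  imports Defs
begin

text \<open>For real \<open>u\<close> the transform is \<open>\<integral> u(x) K(x) dx\<close>, where the kernel \<open>K\<close> is the octonion product of the three
  exponentials.  The algebra of quadruple-complex numbers is commutative and associative, with
  \<open>\<e>\<^sub>1\<close>, \<open>\<e>\<^sub>2\<close> and \<open>\<e>\<^sub>4\<close> squaring to \<open>-1\<close>, and \<open>K\<close> is also the \<open>\<odot>\<close>-product of the three exponentials.
  Hence the factor that depends on \<open>x\<^sub>i\<close> can be moved to the end, and translating \<open>x\<close> by \<open>t\<close> in
  direction \<open>i\<close> multiplies \<open>K(x)\<close> from the right by an exponential of \<open>\<e>\<^sub>1\<close>, \<open>\<e>\<^sub>2\<close> or \<open>\<e>\<^sub>4\<close>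
  (\<open>oft_kernel_translate\<close>).  So \<open>\<partial>\<^sub>i K = - K \<odot> (2 \<pi> f\<^sub>i) e\<close> for that unit \<open>e\<close>, and integration by parts
  turns \<open>\<integral> (\<partial>\<^sub>i u) K\<close> into \<open>(\<integral> u K) \<odot> (2 \<pi> f\<^sub>i) e\<close>, since right multiplication is linear
  (\<open>OFT_partial_deriv\<close>).  Mixed derivatives follow by iteration, the units multiplying like
  \<open>\<e>\<^sub>1 \<odot> \<e>\<^sub>2 = \<e>\<^sub>3\<close>.

  Integration by parts must work for functions that merely have a partial derivative everywhere,
  integrable but possibly discontinuous, in one direction.  By the product rule it reduces to the
  claim that the integral of an integrable directional derivative \<open>g'\<close> of an integrable function \<open>g\<close>
  vanishes (\<open>integral_directional_derivative\<close>).  Almost every \<open>x\<close> satisfies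
  \<open>g(x + v) - g(x) = \<integral>\<^sub>0\<^sup>1 g'(x + t v) dt\<close> by the fundamental theorem of calculus for the
  Henstock-Kurzweil integral, which asks for no regularity of the derivative.  Integrate this
  over \<open>x\<close>: by translation invariance the left-hand side gives \<open>0\<close>, and the right-hand side, after
  exchanging the integrals, gives \<open>\<integral> g'\<close>.  Translating along \<open>v\<close>, rather than splitting the space into
  lines and a complement, treats all directions alike and needs no coordinates.\<close>

section \<open>Translations and Lebesgue measure\<close>

lemma AE_lborel_translate:
  fixes c :: "'a::euclidean_space"
  assumes "AE x in lborel. P x"
  shows "AE x in lborel. P (x + c)"
proof -
  have "AE x in distr lborel borel ((+) c). P x"
    using assms by (simp only: lborel_distr_plus)
  then have "AE x in lborel. P (c + x)"
    by (rule AE_distrD[rotated]) simp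
  then show ?thesis
    by (simp add: add.commute)
qed

text \<open>Each translate of a null set is null, so by Fubini almost every \<open>x\<close> has the property that the
  line through \<open>x\<close> meets the null set in a null set of parameters.\<close>

lemma AE_lborel_along_lines:
  fixes v :: "'a::euclidean_space"
  assumes "AE x in lborel. P x"
  shows "AE x in lborel. AE t in lborel. P (x + t *\<^sub>R v)"
proof -
  obtain N where N: "{x. \<not> P x} \<subseteq> N" "N \<in> null_sets lborel"
    using assms unfolding eventually_ae_filter by auto
  \<comment> \<open>\<open>P\<close> itself may fail to be measurable, so the quantifiers are exchanged for \<open>N\<close>.\<close>
  from N(2) have [measurable]: "N \<in> sets borel" by auto
  have "AE t in lborel. AE x in lborel. x + t *\<^sub>R v \<notin> N"
    by (intro AE_I2 AE_lborel_translate AE_not_in N)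
  then have "AE x in lborel. AE t in lborel. x + t *\<^sub>R v \<notin> N"
    by (subst lborel_pair.AE_commute) measurable
  then show ?thesis
    using N(1) by (elim eventually_mono) auto
qed

lemma has_bochner_integral_lborel_translate:
  fixes h :: "'a::euclidean_space \<Rightarrow> 'b::{banach, second_countable_topology}"
  assumes "has_bochner_integral lborel h I"
  shows "has_bochner_integral lborel (\<lambda>x. h (x + c)) I"
proof -
  have [measurable]: "h \<in> borel_measurable borel"
    using borel_measurable_has_bochner_integral[OF assms] by simp
  have "integrable (distr lborel borel ((+) c)) h \<longleftrightarrow> integrable lborel (\<lambda>x. h (c + x))"
    by (rule integrable_distr_eq) measurable
  moreover have "integral\<^sup>L (distr lborel borel ((+) c)) h = (\<integral>x. h (c + x) \<partial>lborel)"
    by (rule integral_distr) measurable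
  ultimately show ?thesis
    using assms unfolding has_bochner_integral_iff lborel_distr_plus by (simp add: add.commute[of _ c])
qed

text \<open>Tonelli and Fubini are applied to \<open>(x, t) \<mapsto> h (x + t v)\<close> on the product of Borel-Lebesgue measures,
  whose measurability is immediate only if \<open>h\<close> is Borel; a Lebesgue integrable function is
  therefore replaced by a Borel one.\<close>

lemma lebesgue_borel_representative:
  fixes h :: "'a::euclidean_space \<Rightarrow> real"
  assumes "integrable lebesgue h"
  obtains h0 where "h0 \<in> borel_measurable borel" "AE x in lborel. h x = h0 x"
    "has_bochner_integral lborel h0 (integral\<^sup>L lebesgue h)"
proof -
  obtain h0 where h0: "h0 \<in> borel_measurable lborel" "AE x in lborel. h x = h0 x"
    using completion_ex_borel_measurable_real[OF borel_measurable_integrable[OF assms]] by auto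
  have eq: "AE x in lebesgue. h x = h0 x"
    using h0(2) by (rule AE_completion)
  have m: "h0 \<in> borel_measurable lebesgue"
    using h0(1) by (rule measurable_completion)
  have "integrable lebesgue h0"
    using assms integrable_cong_AE[OF borel_measurable_integrable[OF assms] m eq] by simp
  moreover have "integral\<^sup>L lebesgue h = integral\<^sup>L lebesgue h0"
    using integral_cong_AE[OF borel_measurable_integrable[OF assms] m eq] .
  ultimately show thesis
    using h0 that[of h0] integrable_completion[OF h0(1)] integral_completion[OF h0(1)]
    by (simp add: has_bochner_integral_iff)
qed

section \<open>Integration by parts in one direction\<close>

lemma has_vector_derivative_along_line:
  fixes g :: "'a::real_vector \<Rightarrow> 'b::real_normed_vector"
  assumes "\<And>x. ((\<lambda>t. g (x + t *\<^sub>R v)) has_vector_derivative g' x) (at 0)"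
  shows "((\<lambda>t. g (x + t *\<^sub>R v)) has_vector_derivative g' (x + s *\<^sub>R v)) (at s)"
proof -
  have "((\<lambda>t. g (x + s *\<^sub>R v + t *\<^sub>R v)) \<circ> (\<lambda>t. t - s) 
      has_vector_derivative 1 *\<^sub>R g' (x + s *\<^sub>R v)) (at s)"
    using assms[of "x + s *\<^sub>R v"]
    by (intro vector_diff_chain_at) (auto intro!: derivative_eq_intros)
  moreover have "(\<lambda>t. g (x + s *\<^sub>R v + t *\<^sub>R v)) \<circ> (\<lambda>t. t - s) = (\<lambda>t. g (x + t *\<^sub>R v))"
    by (auto simp: algebra_simps)
  ultimately show ?thesis by simp
qed

text \<open>The double integral of \<open>g' (x + t v)\<close> over all \<open>x\<close> and \<open>0 \<le> t \<le> 1\<close> is computed in both orders.  For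
  fixed \<open>t\<close>, translation invariance gives the integral of \<open>g'\<close>.  For almost every fixed \<open>x\<close>, it is
  the increment \<open>g (x + v) - g x\<close>, and the two terms of the increment have the same integral.\<close>

lemma integral_directional_derivative_real:
  fixes g g' :: "'a::euclidean_space \<Rightarrow> real"
  assumes der: "\<And>x. ((\<lambda>t. g (x + t *\<^sub>R v)) has_vector_derivative g' x) (at 0)"
    and g: "integrable lebesgue g" and g': "integrable lebesgue g'"
  shows "integral\<^sup>L lebesgue g' = 0"
proof -
  obtain G where G [measurable]: "G \<in> borel_measurable borel" and gG: "AE x in lborel. g x = G x"
    and intG: "has_bochner_integral lborel G (integral\<^sup>L lebesgue g)"
    using lebesgue_borel_representative[OF g] .
  obtain G' where G' [measurable]: "G' \<in> borel_measurable borel" and gG': "AE x in lborel. g' x = G' x"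
    and intG': "has_bochner_integral lborel G' (integral\<^sup>L lebesgue g')"
    using lebesgue_borel_representative[OF g'] .
  define H where "H x t = indicator {0..1} t * G' (x + t *\<^sub>R v)" for x and t :: real
  have H [measurable]: "(\<lambda>(x, t). H x t) \<in> borel_measurable (lborel \<Otimes>\<^sub>M lborel)"
    unfolding H_def by measurable
  have slice: "has_bochner_integral lborel (\<lambda>x. H x t) (indicator {0..1} t * integral\<^sup>L lebesgue g')" for t
    unfolding H_def
    by (intro has_bochner_integral_mult_right has_bochner_integral_lborel_translate intG')
  have nslice: "(\<integral>x. norm (H x t) \<partial>lborel) = indicator {0..1} t * (\<integral>x. norm (G' x) \<partial>lborel)" for t
    using intG' has_bochner_integral_lborel_translate
      [OF has_bochner_integral_integrable[OF integrable_norm[of lborel G']], of "t *\<^sub>R v"]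
    by (auto simp: H_def has_bochner_integral_iff abs_mult)
  \<comment> \<open>With \<open>t\<close> as the outer variable the inner integrals do not depend on \<open>t\<close> on \<open>{0..1}\<close>, so
    integrability is checked in this order and then transferred to the other one.\<close>
  have "integrable (lborel \<Otimes>\<^sub>M lborel) (\<lambda>(t, x). H x t)"
  proof (rule lborel_pair.Fubini_integrable)
    show "(\<lambda>(t, x). H x t) \<in> borel_measurable (lborel \<Otimes>\<^sub>M lborel)"
      unfolding H_def by measurable
    show "integrable lborel (\<lambda>t. \<integral>x. norm (case (t, x) of (t, x) \<Rightarrow> H x t) \<partial>lborel)"
      by (simp add: nslice[simplified])
    show "AE t in lborel. integrable lborel (\<lambda>x. case (t, x) of (t, x) \<Rightarrow> H x t)"
      using slice by (auto simp: has_bochner_integral_iff)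
  qed
  from lborel_pair.integrable_product_swap[OF this]
  have intH: "integrable (lborel \<Otimes>\<^sub>M lborel) (\<lambda>(x, t). H x t)" by (simp add: case_prod_beta)
  have ftc: "AE x in lborel. (\<integral>t. H x t \<partial>lborel) = G (x + v) - G x"
    using AE_lborel_along_lines[OF gG', of v] lborel_pair.AE_integrable_fst[OF intH] gG AE_lborel_translate[OF gG, of v]
  proof eventually_elim
    case (elim x)
    have "H x = (\<lambda>t. if t \<in> {0..1} then G' (x + t *\<^sub>R v) else 0)"
      by (auto simp: H_def)
    moreover have "(H x has_integral (\<integral>t. H x t \<partial>lborel)) UNIV"
      using elim(2) by (rule has_integral_integral_lborel)
    ultimately have "((\<lambda>t. G' (x + t *\<^sub>R v)) has_integral (\<integral>t. H x t \<partial>lborel)) {0..1}"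
      by (simp only: has_integral_restrict_UNIV)
    then have "((\<lambda>t. g' (x + t *\<^sub>R v)) has_integral (\<integral>t. H x t \<partial>lborel)) {0..1}"
      using elim(1) by (subst has_integral_AE[of "{0..1}" _ "\<lambda>t. G' (x + t *\<^sub>R v)"]) (auto elim: eventually_mono)
    \<comment> \<open>The fundamental theorem needs \<open>g'\<close> itself, as its Borel version \<open>G'\<close> is a derivative only almost
      everywhere; both have the same integral over this line segment.\<close>
    moreover have "((\<lambda>t. g' (x + t *\<^sub>R v)) has_integral g (x + 1 *\<^sub>R v) - g (x + 0 *\<^sub>R v)) {0..1}"
      by (intro fundamental_theorem_of_calculus
          has_vector_derivative_at_within[OF has_vector_derivative_along_line[OF der]]) simp
    ultimately have "(\<integral>t. H x t \<partial>lborel) = g (x + 1 *\<^sub>R v) - g (x + 0 *\<^sub>R v)"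
      by (rule has_integral_unique)
    then show ?case
      using elim(3,4) by simp
  qed
  have "integral\<^sup>L lebesgue g' = (\<integral>t. indicator {0..1::real} t * integral\<^sup>L lebesgue g' \<partial>lborel)"
    by simp
  also have "\<dots> = (\<integral>t. \<integral>x. H x t \<partial>lborel \<partial>lborel)"
    by (intro Bochner_Integration.integral_cong has_bochner_integral_integral_eq[symmetric] slice refl)
  also have "\<dots> = (\<integral>x. \<integral>t. H x t \<partial>lborel \<partial>lborel)"
    using lborel_pair.Fubini_integral[OF intH] .
  also have "\<dots> = (\<integral>x. G (x + v) - G x \<partial>lborel)"
  proof (rule integral_cong_AE)
    show "(\<lambda>x. \<integral>t. H x t \<partial>lborel) \<in> borel_measurable lborel"
      using lborel_pair.integrable_fst[OF intH] by (rule borel_measurable_integrable)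
    show "(\<lambda>x. G (x + v) - G x) \<in> borel_measurable lborel"
      by measurable
  qed (rule ftc)
  also have "\<dots> = 0"
    using has_bochner_integral_diff[OF has_bochner_integral_lborel_translate[OF intG, of v] intG]
    by (simp add: has_bochner_integral_iff)
  finally show ?thesis .
qed

lemma integral_directional_derivative:
  fixes g g' :: "'a::euclidean_space \<Rightarrow> 'b::euclidean_space"
  assumes der: "\<And>x. ((\<lambda>t. g (x + t *\<^sub>R v)) has_vector_derivative g' x) (at 0)"
    and g: "integrable lebesgue g" and g': "integrable lebesgue g'"
  shows "integral\<^sup>L lebesgue g' = 0"
proof (rule euclidean_eqI)
  fix b :: 'b
  have "(\<integral>x. g' x \<bullet> b \<partial>lebesgue) = 0"
  proof (rule integral_directional_derivative_real)
    show "((\<lambda>t. g (x + t *\<^sub>R v) \<bullet> b) has_vector_derivative g' x \<bullet> b) (at 0)" for x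
      using bounded_linear.has_vector_derivative[OF bounded_linear_inner_left der] .
  qed (use g g' in simp_all)
  then show "integral\<^sup>L lebesgue g' \<bullet> b = 0 \<bullet> b"
    using g' by simp
qed

lemma integrable_scaleR_bounded:
  fixes a :: "'a \<Rightarrow> real" and w :: "'a \<Rightarrow> 'b::{banach, second_countable_topology}"
  assumes "integrable M a" and "w \<in> borel_measurable M" and "\<And>x. norm (w x) \<le> B"
  shows "integrable M (\<lambda>x. a x *\<^sub>R w x)"
proof (rule Bochner_Integration.integrable_bound)
  show "integrable M (\<lambda>x. a x * B)" using assms(1) by simp
  show "AE x in M. norm (a x *\<^sub>R w x) \<le> norm (a x * B)"
    using assms(3) by (intro AE_I2) (auto simp: abs_mult intro!: mult_left_mono intro: order_trans[OF _ abs_ge_self])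
qed (use assms in measurable)

lemma integral_by_parts_directional:
  fixes a a' :: "'a::euclidean_space \<Rightarrow> real" and w w' :: "'a \<Rightarrow> 'b::euclidean_space"
  assumes a: "\<And>x. ((\<lambda>t. a (x + t *\<^sub>R v)) has_vector_derivative a' x) (at 0)"
    and w: "\<And>x. ((\<lambda>t. w (x + t *\<^sub>R v)) has_vector_derivative w' x) (at 0)"
    and int: "integrable lebesgue (\<lambda>x. a x *\<^sub>R w x)"
      "integrable lebesgue (\<lambda>x. a' x *\<^sub>R w x)" "integrable lebesgue (\<lambda>x. a x *\<^sub>R w' x)"
  shows "(\<integral>x. a' x *\<^sub>R w x \<partial>lebesgue) = - (\<integral>x. a x *\<^sub>R w' x \<partial>lebesgue)"
proof -
  have "(\<integral>x. a x *\<^sub>R w' x + a' x *\<^sub>R w x \<partial>lebesgue) = 0"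
  proof (rule integral_directional_derivative)
    show "((\<lambda>t. a (x + t *\<^sub>R v) *\<^sub>R w (x + t *\<^sub>R v)) has_vector_derivative a x *\<^sub>R w' x + a' x *\<^sub>R w x) (at 0)" for x
      using has_vector_derivative_scaleR[of "\<lambda>t. a (x + t *\<^sub>R v)" "a' x", OF _ w[of x]] a[of x]
      by (simp add: has_real_derivative_iff_has_vector_derivative)
  qed (use int in auto)
  then show ?thesis
    using int(2,3) by (simp add: eq_neg_iff_add_eq_0 add.commute)
qed

section \<open>The kernel of the transform\<close>

definition oft_kernel :: "real^3 \<Rightarrow> real^3 \<Rightarrow> octonion" where
  "oft_kernel f x = oct_exp \<e>\<^sub>1 (- (2 * pi * f $ 1 * x $ 1))
                     \<cdot>\<^sub>O oct_exp \<e>\<^sub>2 (- (2 * pi * f $ 2 * x $ 2))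
                     \<cdot>\<^sub>O oct_exp \<e>\<^sub>4 (- (2 * pi * f $ 3 * x $ 3))"

lemma oft_kernel_coordinates:
  "oft_kernel f x = (let
      c1 = cos (2 * pi * f $ 1 * x $ 1); s1 = sin (2 * pi * f $ 1 * x $ 1);
      c2 = cos (2 * pi * f $ 2 * x $ 2); s2 = sin (2 * pi * f $ 2 * x $ 2);
      c3 = cos (2 * pi * f $ 3 * x $ 3); s3 = sin (2 * pi * f $ 3 * x $ 3) in
    ((c1 * c2 * c3, - (s1 * c2 * c3), - (c1 * s2 * c3), s1 * s2 * c3),
     (- (c1 * c2 * s3), s1 * c2 * s3, c1 * s2 * s3, - (s1 * s2 * s3))))"
  by (simp add: oft_kernel_def oct_exp_def oct_of_real_def oct_unit_defs zero_prod_def Let_def)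

text \<open>A real factor on the left can be pulled out of the non-associative product.\<close>

lemma OFT_real_kernel: "OFT_real u f = (\<integral>x. u x *\<^sub>R oft_kernel f x \<partial>lebesgue)"
  by (simp add: OFT_def oft_kernel_def oct_exp_def oct_of_real_def oct_unit_defs zero_prod_def algebra_simps)

lemma linear_quadruple_oct_mult_left: "linear (\<lambda>p. p \<odot> q)"
  by (cases q rule: quadruple_of_oct.cases)
    (auto intro!: linearI simp: quadruple_oct_mult_def algebra_simps)

lemma quadruple_oct_mult_scaleR_right: "p \<odot> (c *\<^sub>R q) = c *\<^sub>R (p \<odot> q)"
  by (cases p rule: quadruple_of_oct.cases; cases q rule: quadruple_of_oct.cases)
    (simp add: quadruple_oct_mult_def algebra_simps)

lemma quadruple_oct_mult_units:
  "p \<odot> \<e>\<^sub>1 \<odot> \<e>\<^sub>2 = p \<odot> \<e>\<^sub>3"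
  "p \<odot> \<e>\<^sub>1 \<odot> \<e>\<^sub>4 = p \<odot> \<e>\<^sub>5"
  "p \<odot> \<e>\<^sub>2 \<odot> \<e>\<^sub>4 = p \<odot> \<e>\<^sub>6"
  "p \<odot> \<e>\<^sub>3 \<odot> \<e>\<^sub>4 = p \<odot> \<e>\<^sub>7"
  by (cases p rule: quadruple_of_oct.cases, simp add: quadruple_oct_mult_def oct_unit_defs)+

text \<open>The addition theorem for the quadruple-complex exponential: the right-hand sides are
  \<open>K(x) \<odot> exp (- 2 \<pi> f\<^sub>i t e)\<close>.  With the octonion product this fails in general for the first two directions,
  since the factor of the kernel that changes is not the last one.\<close>

lemma oft_kernel_translate:
  "oft_kernel f (x + t *\<^sub>R axis 1 1) = cos (2 * pi * f $ 1 * t) *\<^sub>R oft_kernel f x - sin (2 * pi * f $ 1 * t) *\<^sub>R (oft_kernel f x \<odot> \<e>\<^sub>1)"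
  "oft_kernel f (x + t *\<^sub>R axis 2 1) = cos (2 * pi * f $ 2 * t) *\<^sub>R oft_kernel f x - sin (2 * pi * f $ 2 * t) *\<^sub>R (oft_kernel f x \<odot> \<e>\<^sub>2)"
  "oft_kernel f (x + t *\<^sub>R axis 3 1) = cos (2 * pi * f $ 3 * t) *\<^sub>R oft_kernel f x - sin (2 * pi * f $ 3 * t) *\<^sub>R (oft_kernel f x \<odot> \<e>\<^sub>4)"
  by (simp_all add: oft_kernel_coordinates Let_def quadruple_oct_mult_def oct_unit_defs axis_def
      distrib_left cos_add sin_add) (simp_all add: algebra_simps)

lemma oft_kernel_measurable: "oft_kernel f \<in> borel_measurable lebesgue"
proof -
  have "continuous_on UNIV (oft_kernel f)"
    unfolding oft_kernel_coordinates[abs_def] Let_def by (intro continuous_intros)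
  then have "oft_kernel f \<in> borel_measurable lborel"
    using borel_measurable_continuous_onI by simp
  then show ?thesis
    by (rule measurable_completion)
qed

text \<open>The kernel has norm \<open>1\<close>; a crude bound suffices for integrability of its products with \<open>u\<close>.\<close>

lemma norm_oft_kernel_le: "norm (oft_kernel f x) \<le> 8"
proof -
  have triple: "\<bar>p * q * r\<bar> \<le> 1" if "\<bar>p\<bar> \<le> 1" "\<bar>q\<bar> \<le> 1" "\<bar>r\<bar> \<le> 1" for p q r :: real
    using that by (simp add: abs_mult mult_le_one)
  have sum8: "norm ((a0, a1, a2, a3), (a4, a5, a6, a7)) \<le> 8"
    if "\<bar>a0\<bar> \<le> 1" "\<bar>a1\<bar> \<le> 1" "\<bar>a2\<bar> \<le> 1" "\<bar>a3\<bar> \<le> 1" "\<bar>a4\<bar> \<le> 1" "\<bar>a5\<bar> \<le> 1" "\<bar>a6\<bar> \<le> 1" "\<bar>a7\<bar> \<le> 1"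
    for a0 a1 a2 a3 a4 a5 a6 a7 :: real
  proof -
    have quad: "norm (a, b, c, d) \<le> \<bar>a\<bar> + (\<bar>b\<bar> + (\<bar>c\<bar> + \<bar>d\<bar>))" for a b c d :: real
      by (intro order_trans[OF norm_Pair_le] add_mono) simp_all
    have "norm ((a0, a1, a2, a3), (a4, a5, a6, a7)) \<le>
        (\<bar>a0\<bar> + (\<bar>a1\<bar> + (\<bar>a2\<bar> + \<bar>a3\<bar>))) + (\<bar>a4\<bar> + (\<bar>a5\<bar> + (\<bar>a6\<bar> + \<bar>a7\<bar>)))"
      by (rule order_trans[OF norm_Pair_le add_mono[OF quad quad]])
    with that show ?thesis by linarith
  qed
  show ?thesis
    unfolding oft_kernel_coordinates Let_def
    by (intro sum8; (simp only: abs_minus_cancel)?; intro triple abs_cos_le_one abs_sin_le_one)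
qed

section \<open>Transforms of partial derivatives\<close>

text \<open>The translation law makes \<open>- K \<odot> (\<omega> e)\<close> the derivative of the kernel in direction \<open>i\<close>, and
  integration by parts moves the derivative from \<open>u\<close> to the kernel.\<close>

lemma OFT_partial_deriv:
  assumes u: "integrable lebesgue u" and u': "has_integrable_partial_deriv i u"
    and translate: "\<And>x t. oft_kernel f (x + t *\<^sub>R axis i 1) =
      cos (\<omega> * t) *\<^sub>R oft_kernel f x - sin (\<omega> * t) *\<^sub>R (oft_kernel f x \<odot> e)"
  shows "OFT_real (partial_deriv i u) f = OFT_real u f \<odot> (\<omega> *\<^sub>R e)"
proof -
  let ?K = "oft_kernel f"
  have lin: "bounded_linear (\<lambda>p. p \<odot> (\<omega> *\<^sub>R e))"
    using linear_quadruple_oct_mult_left by (simp add: linear_conv_bounded_linear)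
  have int: "integrable lebesgue (\<lambda>x. a x *\<^sub>R ?K x)" if "integrable lebesgue a" for a
    using that oft_kernel_measurable norm_oft_kernel_le by (rule integrable_scaleR_bounded)
  have pull: "a *\<^sub>R (p \<odot> (\<omega> *\<^sub>R e)) = (a *\<^sub>R p) \<odot> (\<omega> *\<^sub>R e)" for a p
    using linear_scale[OF linear_quadruple_oct_mult_left] by simp
  have intu: "integrable lebesgue (\<lambda>x. u x *\<^sub>R (?K x \<odot> (\<omega> *\<^sub>R e)))"
    unfolding pull using integrable_bounded_linear[OF lin int[OF u]] .
  have "OFT_real (partial_deriv i u) f = (\<integral>x. partial_deriv i u x *\<^sub>R ?K x \<partial>lebesgue)"
    by (rule OFT_real_kernel)
  also have "\<dots> = - (\<integral>x. u x *\<^sub>R - (?K x \<odot> (\<omega> *\<^sub>R e)) \<partial>lebesgue)"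
  proof (rule integral_by_parts_directional)
    show "((\<lambda>t. u (x + t *\<^sub>R axis i 1)) has_vector_derivative partial_deriv i u x) (at 0)" for x
      using u' unfolding has_integrable_partial_deriv_def has_partial_deriv_def partial_deriv_def
      by (simp add: DERIV_deriv_iff_real_differentiable flip: has_real_derivative_iff_has_vector_derivative)
    show "((\<lambda>t. ?K (x + t *\<^sub>R axis i 1)) has_vector_derivative - (?K x \<odot> (\<omega> *\<^sub>R e))) (at 0)" for x
      unfolding translate quadruple_oct_mult_scaleR_right
      by (auto intro!: derivative_eq_intros)
  qed (use int u u' intu in \<open>auto simp: has_integrable_partial_deriv_def\<close>)
  also have "\<dots> = (\<integral>x. (u x *\<^sub>R ?K x) \<odot> (\<omega> *\<^sub>R e) \<partial>lebesgue)"
    by (simp add: pull)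
  also have "\<dots> = OFT_real u f \<odot> (\<omega> *\<^sub>R e)"
    unfolding OFT_real_kernel using integral_bounded_linear[OF lin int[OF u]] .
  finally show ?thesis .
qed

theorem corollary5:
  fixes u :: "real^3 \<Rightarrow> real" and f :: "real^3"
  assumes "integrable lebesgue u"
    and "has_integrable_partial_deriv 1 u"
    and "has_integrable_partial_deriv 2 u"
    and "has_integrable_partial_deriv 2 (partial_deriv 1 u)"
    and "has_integrable_partial_deriv 3 u"
    and "has_integrable_partial_deriv 3 (partial_deriv 1 u)"
    and "has_integrable_partial_deriv 3 (partial_deriv 2 u)"
    and "has_integrable_partial_deriv 3 (partial_deriv 2 (partial_deriv 1 u))"
  shows "OFT_real (partial_deriv 1 u) f =
       OFT_real u f \<odot> ((2 * pi * f $ 1) *\<^sub>R \<e>\<^sub>1) \<and>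
     OFT_real (partial_deriv 2 u) f =
       OFT_real u f \<odot> ((2 * pi * f $ 2) *\<^sub>R \<e>\<^sub>2) \<and>
     OFT_real (partial_deriv 2 (partial_deriv 1 u)) f =
       OFT_real u f \<odot> (((2 * pi * f $ 1) * (2 * pi * f $ 2)) *\<^sub>R \<e>\<^sub>3) \<and>
     OFT_real (partial_deriv 3 u) f =
       OFT_real u f \<odot> ((2 * pi * f $ 3) *\<^sub>R \<e>\<^sub>4) \<and>
     OFT_real (partial_deriv 3 (partial_deriv 1 u)) f =
       OFT_real u f \<odot> (((2 * pi * f $ 1) * (2 * pi * f $ 3)) *\<^sub>R \<e>\<^sub>5) \<and>
     OFT_real (partial_deriv 3 (partial_deriv 2 u)) f =
       OFT_real u f \<odot> (((2 * pi * f $ 2) * (2 * pi * f $ 3)) *\<^sub>R \<e>\<^sub>6) \<and>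
     OFT_real (partial_deriv 3 (partial_deriv 2 (partial_deriv 1 u))) f =
       OFT_real u f \<odot> (((2 * pi * f $ 1) * (2 * pi * f $ 2) * (2 * pi * f $ 3)) *\<^sub>R \<e>\<^sub>7)"
proof -
  note OFT1 = OFT_partial_deriv[OF _ _ oft_kernel_translate(1)]
    and OFT2 = OFT_partial_deriv[OF _ _ oft_kernel_translate(2)]
    and OFT3 = OFT_partial_deriv[OF _ _ oft_kernel_translate(3)]
  have u: "integrable lebesgue u" "integrable lebesgue (partial_deriv 1 u)"
    "integrable lebesgue (partial_deriv 2 u)" "integrable lebesgue (partial_deriv 2 (partial_deriv 1 u))"
    using assms by (auto simp: has_integrable_partial_deriv_def)
  have iterate: "p \<odot> (a *\<^sub>R d) \<odot> (b *\<^sub>R e) = p \<odot> ((a * b) *\<^sub>R d')"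
    if "\<And>p. p \<odot> d \<odot> e = p \<odot> d'" for a b p d e d'
    using that linear_scale[OF linear_quadruple_oct_mult_left, of a]
    by (simp only: quadruple_oct_mult_scaleR_right scaleR_scaleR mult.commute)
  show ?thesis
    by (simp only: u assms OFT1 OFT2 OFT3 quadruple_oct_mult_units[THEN iterate] simp_thms)
qed

end
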